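(* Let $\varepsilon>0$ with $\Lambda_\varepsilon>0$, let $P_0$ be non-atomic, and let $P_\varepsilon$ be an $\varepsilon$-NormCRM$(\rho,\kappa P_0)$ with eppf $p_\varepsilon$. For every Borel set $B\subset\Theta$ and every $m=1,2,\dots$, $$\mathbb{E}\big(P_\varepsilon(B)^m\big)=\mathbb{E}\big(P_0(B)^{K_m}\big),$$ where $K_m$ is the number of distinct values in a sample of size $m$ from $P_\varepsilon$. In particular, $$\operatorname{Var}(P_\varepsilon(B))=p_\varepsilon(2)\,P_0(B)\,(1-P_0(B)).$$ Moreover, for all Borel sets $B_1,B_2\subset\Theta$, $$\operatorname{Cov}\big(P_\varepsilon(B_1),P_\varepsilon(B_2)\big)=p_\varepsilon(2)\,\big(P_0(B_1\cap B_2)-P_0(B_1)P_0(B_2)\big).$$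
   Context: Setting. $\Theta\subset\mathbb{R}^d$ is a Borel set, $P_0$ is a probability measure on $\Theta$, $\kappa>0$, and $\rho:(0,+\infty)\to[0,+\infty)$ is measurable with $\int_0^{+\infty}\min\{1,s\}\rho(s)\,ds<\infty$ and $\int_0^{+\infty}\rho(s)\,ds=+\infty$. For $\varepsilon>0$ put $\Lambda_\varepsilon:=\kappa\int_\varepsilon^{+\infty}\rho(s)\,ds$ (which is finite) and, when $\Lambda_\varepsilon>0$, let $\rho_\varepsilon(s):=\frac{\kappa\rho(s)}{\Lambda_\varepsilon}\mathbb{I}_{(\varepsilon,+\infty)}(s)$, a probability density. $\varepsilon$-NormCRM$(\rho,\kappa P_0)$: let $N_\varepsilon\sim\text{Poisson}(\Lambda_\varepsilon)$; conditionally on $N_\varepsilon$, let $J_0,J_1,\dots,J_{N_\varepsilon}$ be iid with density $\rho_\varepsilon$ and, independently of these, let $\tau_0,\dots,\tau_{N_\varepsilon}$ be iid from $P_0$. With $T_\varepsilon=\sum_{j=0}^{N_\varepsilon}J_j$, the random probability measure $P_\varepsilon=\sum_{j=0}^{N_\varepsilon}\frac{J_j}{T_\varepsilon}\delta_{\tau_j}$ is called an $\varepsilon$-NormCRM$(\rho,\kappa P_0)$. A sample of size $m$ from $P_\varepsilon$ is a vector $(\theta_1,\dots,\theta_m)$ which, conditionally on $P_\varepsilon$, is iid from $P_\varepsilon$. The eppf $p_\varepsilon(n_1,\dots,n_k)$ is the probability that the random partition of $\{1,\dots,n\}$ ($n=\sum n_i$) induced by ties in a sample of size $n$ from $P_\varepsilon$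 equals a given partition with block sizes $n_1,\dots,n_k$. In particular $p_\varepsilon(2)$ is the probability that the two values in a sample of size 2 from $P_\varepsilon$ coincide. *)

theory Defs
  imports "HOL-Probability.Probability"
begin

definition nonatomic :: "'a measure \<Rightarrow> bool" where
  "nonatomic M \<longleftrightarrow>
     \<not> (\<exists>A\<in>sets M. 0 < emeasure M A \<and>
          (\<forall>B\<in>sets M. B \<subseteq> A \<and> emeasure M B < emeasure M A \<longrightarrow> emeasure M B = 0))"

definition covariance :: "'w measure \<Rightarrow> ('w \<Rightarrow> real) \<Rightarrow> ('w \<Rightarrow> real) \<Rightarrow> real" where
  "covariance M X Y =
     (\<integral>\<omega>. (X \<omega> - integral\<^sup>L M X) * (Y \<omega> - integral\<^sup>L M Y) \<partial>M)"


section \<open>Epsilon-NormCRM processes\<close>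

definition Lam :: "(real \<Rightarrow> real) \<Rightarrow> real \<Rightarrow> real \<Rightarrow> real" where
  "Lam \<rho> \<kappa> \<epsilon> = \<kappa> * (LINT s:{\<epsilon><..}|lborel. \<rho> s)"

definition rho_eps :: "(real \<Rightarrow> real) \<Rightarrow> real \<Rightarrow> real \<Rightarrow> real \<Rightarrow> real" where
  "rho_eps \<rho> \<kappa> \<epsilon> s = \<kappa> * \<rho> s / Lam \<rho> \<kappa> \<epsilon> * indicator {\<epsilon><..} s"

text \<open>Only \<open>J 0, \<dots>, J (N \<omega>)\<close> and \<open>\<tau> 0, \<dots>, \<tau> (N \<omega>)\<close> matter; the variables of larger index are
  arbitrary fillers, on which the law imposes nothing. The last clause gives the conditional
  law of the jumps and locations on the event \<open>N = n\<close>, which has positive probability. The jumps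
  take values in \<open>(0, \<infinity>)\<close> everywhere, so that the normalization never degenerates.\<close>

definition eps_NormCRM_variables ::
  "(real \<Rightarrow> real) \<Rightarrow> real \<Rightarrow> 'a measure \<Rightarrow> real \<Rightarrow> 'w measure
     \<Rightarrow> ('w \<Rightarrow> nat) \<Rightarrow> (nat \<Rightarrow> 'w \<Rightarrow> real) \<Rightarrow> (nat \<Rightarrow> 'w \<Rightarrow> 'a) \<Rightarrow> bool" where
  "eps_NormCRM_variables \<rho> \<kappa> P0 \<epsilon> M N J \<tau> \<longleftrightarrow>
     N \<in> M \<rightarrow>\<^sub>M count_space UNIV \<and>
     (\<forall>j. J j \<in> M \<rightarrow>\<^sub>M borel) \<and>
     (\<forall>j. \<tau> j \<in> M \<rightarrow>\<^sub>M P0) \<and>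
     (\<forall>\<omega>\<in>space M. \<forall>j\<le>N \<omega>. 0 < J j \<omega>) \<and>
     distr M (count_space UNIV) N = measure_pmf (poisson_pmf (Lam \<rho> \<kappa> \<epsilon>)) \<and>
     (\<forall>n. distr (uniform_measure M {\<omega>\<in>space M. N \<omega> = n})
            ((\<Pi>\<^sub>M j\<in>{..n}. borel) \<Otimes>\<^sub>M (\<Pi>\<^sub>M j\<in>{..n}. P0))
            (\<lambda>\<omega>. (\<lambda>j\<in>{..n}. J j \<omega>, \<lambda>j\<in>{..n}. \<tau> j \<omega>))
          = (\<Pi>\<^sub>M j\<in>{..n}. density lborel (\<lambda>s. ennreal (rho_eps \<rho> \<kappa> \<epsilon> s)))
              \<Otimes>\<^sub>M (\<Pi>\<^sub>M j\<in>{..n}. P0))"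

text \<open>The measure \<open>\<Sum>j\<le>n. (J j / T) \<delta>\<^sub>\<tau>\<^sub>j\<close> with \<open>T = \<Sum>j\<le>n. J j\<close>, on the measurable space \<open>S\<close>.\<close>

definition normalized_atoms :: "'a measure \<Rightarrow> nat \<Rightarrow> (nat \<Rightarrow> real) \<Rightarrow> (nat \<Rightarrow> 'a) \<Rightarrow> 'a measure" where
  "normalized_atoms S n J \<tau> =
     measure_of (space S) (sets S)
       (\<lambda>B. \<Sum>j\<le>n. ennreal (J j / (\<Sum>i\<le>n. J i)) * emeasure (return S (\<tau> j)) B)"

definition eps_NormCRM ::
  "(real \<Rightarrow> real) \<Rightarrow> real \<Rightarrow> 'a measure \<Rightarrow> real \<Rightarrow> 'w measure \<Rightarrow> ('w \<Rightarrow> 'a measure) \<Rightarrow> bool" where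
  "eps_NormCRM \<rho> \<kappa> P0 \<epsilon> M P \<longleftrightarrow>
     (\<exists>N J \<tau>. eps_NormCRM_variables \<rho> \<kappa> P0 \<epsilon> M N J \<tau> \<and>
        (\<forall>\<omega>\<in>space M. P \<omega> = normalized_atoms P0 (N \<omega>) (\<lambda>j. J j \<omega>) (\<lambda>j. \<tau> j \<omega>)))"

lemma sets_normalized_atoms [simp]: "sets (normalized_atoms S n J \<tau>) = sets S"
  by (simp add: normalized_atoms_def sets.sigma_sets_eq)

lemma space_normalized_atoms [simp]: "space (normalized_atoms S n J \<tau>) = space S"
  by (simp add: normalized_atoms_def space_measure_of_conv)

lemma emeasure_normalized_atoms:
  assumes "B \<in> sets S"
  shows "emeasure (normalized_atoms S n J \<tau>) B
           = (\<Sum>j\<le>n. ennreal (J j / (\<Sum>i\<le>n. J i)) * indicator B (\<tau> j))"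
proof -
  let ?\<mu> = "\<lambda>B. \<Sum>j\<le>n. ennreal (J j / (\<Sum>i\<le>n. J i)) * emeasure (return S (\<tau> j)) B"
  have "countably_additive (sets S) ?\<mu>"
  proof (rule countably_additiveI)
    fix A :: "nat \<Rightarrow> _" assume A: "range A \<subseteq> sets S" "disjoint_family A"
    have "(\<Sum>i. ?\<mu> (A i)) = (\<Sum>j\<le>n. \<Sum>i. ennreal (J j / (\<Sum>i\<le>n. J i)) * emeasure (return S (\<tau> j)) (A i))"
      by (rule suminf_sum) auto
    also have "\<dots> = ?\<mu> (\<Union>i. A i)"
      using A by (intro sum.cong) (simp_all add: suminf_emeasure del: emeasure_return)
    finally show "(\<Sum>i. ?\<mu> (A i)) = ?\<mu> (\<Union>i. A i)" .
  qed
  then have "emeasure (normalized_atoms S n J \<tau>) B = ?\<mu> B"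
    using assms by (intro emeasure_measure_of[OF normalized_atoms_def])
      (auto simp: positive_def sets.space_closed)
  then show ?thesis using assms by simp
qed

lemma prob_space_normalized_atoms:
  assumes "\<And>j. j \<le> n \<Longrightarrow> 0 < J j" "\<And>j. j \<le> n \<Longrightarrow> \<tau> j \<in> space S"
  shows "prob_space (normalized_atoms S n J \<tau>)"
proof
  have pos: "0 < (\<Sum>i\<le>n. J i)" using assms(1) by (intro sum_pos) auto
  have "emeasure (normalized_atoms S n J \<tau>) (space S) = (\<Sum>j\<le>n. ennreal (J j / (\<Sum>i\<le>n. J i)))"
    using assms(2) by (simp add: emeasure_normalized_atoms)
  also have "\<dots> = ennreal (\<Sum>j\<le>n. J j / (\<Sum>i\<le>n. J i))"
    using assms(1) pos by (intro sum_ennreal) (auto intro!: divide_nonneg_pos less_imp_le)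
  also have "\<dots> = 1" using pos by (simp flip: sum_divide_distrib)
  finally show "emeasure (normalized_atoms S n J \<tau>) (space (normalized_atoms S n J \<tau>)) = 1" by simp
qed

lemma measurable_eps_NormCRM:
  assumes "eps_NormCRM \<rho> \<kappa> P0 \<epsilon> M P"
  shows "P \<in> M \<rightarrow>\<^sub>M prob_algebra P0"
proof -
  from assms obtain N J \<tau> where
    V: "eps_NormCRM_variables \<rho> \<kappa> P0 \<epsilon> M N J \<tau>" and
    P: "\<And>\<omega>. \<omega> \<in> space M \<Longrightarrow> P \<omega> = normalized_atoms P0 (N \<omega>) (\<lambda>j. J j \<omega>) (\<lambda>j. \<tau> j \<omega>)"
    unfolding eps_NormCRM_def by blast
  have [measurable]: "N \<in> M \<rightarrow>\<^sub>M count_space UNIV" "\<And>j. J j \<in> M \<rightarrow>\<^sub>M borel" "\<And>j. \<tau> j \<in> M \<rightarrow>\<^sub>M P0"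
    and J: "\<And>\<omega> j. \<omega> \<in> space M \<Longrightarrow> j \<le> N \<omega> \<Longrightarrow> 0 < J j \<omega>"
    using V unfolding eps_NormCRM_variables_def by auto
  have prob: "prob_space (P \<omega>)" if "\<omega> \<in> space M" for \<omega>
    unfolding P[OF that]
    by (intro prob_space_normalized_atoms J that measurable_space[of "\<tau> _" M P0]) auto
  show ?thesis
  proof (rule measurable_prob_algebraI[OF prob], assumption, rule measurable_subprob_algebra)
    fix B assume [measurable]: "B \<in> sets P0"
    have "(\<lambda>\<omega>. emeasure (P \<omega>) B) \<in> borel_measurable M \<longleftrightarrow>
          (\<lambda>\<omega>. \<Sum>j\<le>N \<omega>. ennreal (J j \<omega> / (\<Sum>i\<le>N \<omega>. J i \<omega>)) * indicator B (\<tau> j \<omega>))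
             \<in> borel_measurable M"
      by (intro measurable_cong) (simp add: P emeasure_normalized_atoms)
    also have "\<dots>"
      by (rule measurable_compose_countable[where g = N and
          f = "\<lambda>n \<omega>. \<Sum>j\<le>n. ennreal (J j \<omega> / (\<Sum>i\<le>n. J i \<omega>)) * indicator B (\<tau> j \<omega>)"])
        measurable
    finally show "(\<lambda>\<omega>. emeasure (P \<omega>) B) \<in> borel_measurable M" .
  qed (use prob P in \<open>auto simp: prob_space_imp_subprob_space\<close>)
qed


section \<open>Samples from a random probability measure\<close>

text \<open>The law of a vector \<open>(\<theta> 0, \<dots>, \<theta> (m - 1))\<close> which, conditionally on the random
  probability measure \<open>P\<close> defined on \<open>M\<close>, is iid from \<open>P\<close>: draw \<open>\<omega>\<close> from \<open>M\<close>, then the vector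
  from the \<open>m\<close>-fold product of \<open>P \<omega>\<close>. It always exists, whereas \<open>M\<close> itself may be too small to
  carry such a vector; lemma \<open>distr_sample\<close> below shows that every sample has this law.\<close>

definition sample_law :: "'w measure \<Rightarrow> ('w \<Rightarrow> 'a measure) \<Rightarrow> nat \<Rightarrow> (nat \<Rightarrow> 'a) measure" where
  "sample_law M P m = M \<bind> (\<lambda>\<omega>. \<Pi>\<^sub>M i\<in>{..<m}. P \<omega>)"

definition sample ::
  "'w measure \<Rightarrow> 'a measure \<Rightarrow> ('w \<Rightarrow> 'a measure) \<Rightarrow> nat \<Rightarrow> (nat \<Rightarrow> 'w \<Rightarrow> 'a) \<Rightarrow> bool" where
  "sample M S P m \<theta> \<longleftrightarrow>
     (\<forall>i<m. \<theta> i \<in> M \<rightarrow>\<^sub>M S) \<and>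
     (\<forall>A. (\<forall>i<m. A i \<in> sets S) \<longrightarrow>
        (AE \<omega> in M.
           real_cond_exp M (vimage_algebra (space M) P (prob_algebra S))
             (indicator {\<omega>\<in>space M. \<forall>i<m. \<theta> i \<omega> \<in> A i}) \<omega>
           = (\<Prod>i<m. measure (P \<omega>) (A i))))"

lemma measurable_sample_kernel:
  assumes P: "P \<in> M \<rightarrow>\<^sub>M prob_algebra S"
  shows "(\<lambda>\<omega>. \<Pi>\<^sub>M i\<in>{..<m}. P \<omega>) \<in> M \<rightarrow>\<^sub>M prob_algebra (\<Pi>\<^sub>M i\<in>{..<m::nat}. S)"
proof -
  have P': "prob_space (P \<omega>)" "sets (P \<omega>) = sets S" if "\<omega> \<in> space M" for \<omega>
    using measurable_space[OF P that] by (auto simp: space_prob_algebra)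
  show ?thesis
  proof (rule measurable_prob_algebra_generated[OF sets_PiM Int_stable_prod_algebra prod_algebra_sets_into_space])
    fix A assume "A \<in> prod_algebra {..<m} (\<lambda>_. S)"
    then obtain E where A: "A = Pi\<^sub>E {..<m} E" and E: "\<And>i. i < m \<Longrightarrow> E i \<in> sets S"
      by (auto simp: prod_algebra_eq_finite)
    have "(\<lambda>\<omega>. emeasure (\<Pi>\<^sub>M i\<in>{..<m}. P \<omega>) A) \<in> borel_measurable M \<longleftrightarrow>
          (\<lambda>\<omega>. \<Prod>i<m. emeasure (P \<omega>) (E i)) \<in> borel_measurable M"
    proof (rule measurable_cong)
      fix \<omega> assume \<omega>: "\<omega> \<in> space M"
      interpret prob_space "P \<omega>" by (rule P'(1)[OF \<omega>])
      interpret product_sigma_finite "\<lambda>_::nat. P \<omega>" ..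
      show "emeasure (\<Pi>\<^sub>M i\<in>{..<m}. P \<omega>) A = (\<Prod>i<m. emeasure (P \<omega>) (E i))"
        unfolding A using E P'(2)[OF \<omega>] by (intro emeasure_PiM) auto
    qed
    also have "\<dots>"
      using E measurable_compose[OF measurable_prob_algebraD[OF P] measurable_emeasure_subprob_algebra]
      by (intro borel_measurable_prod_ennreal) auto
    finally show "(\<lambda>\<omega>. emeasure (\<Pi>\<^sub>M i\<in>{..<m}. P \<omega>) A) \<in> borel_measurable M" .
  qed (use P' in \<open>auto intro!: prob_space_PiM sets_PiM_cong\<close>)
qed

lemma box_vimage:
  "{\<omega>\<in>space M. \<forall>i<m. \<theta> i \<omega> \<in> A i}
     = (\<lambda>\<omega>. \<lambda>i\<in>{..<m::nat}. \<theta> i \<omega>) -` Pi\<^sub>E {..<m} A \<inter> space M"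
  by (auto simp: PiE_def Pi_def)

lemma distr_sample:
  assumes M: "prob_space M" and P: "P \<in> M \<rightarrow>\<^sub>M prob_algebra S" and "sample M S P m \<theta>"
  shows "distr M (\<Pi>\<^sub>M i\<in>{..<m}. S) (\<lambda>\<omega>. \<lambda>i\<in>{..<m}. \<theta> i \<omega>) = sample_law M P m"
proof -
  let ?F = "vimage_algebra (space M) P (prob_algebra S)"
  interpret prob_space M by (rule M)
  have sub: "subalgebra M ?F"
    unfolding subalgebra_def using P
    by (auto simp: sets_vimage_algebra2 measurable_space intro: measurable_sets)
  have sfs: "sigma_finite_subalgebra M ?F"
    by (intro finite_measure_subalgebra_is_sigma_finite finite_measure_subalgebra.intro
        finite_measure_subalgebra_axioms.intro sub finite_measure_axioms)
  have \<theta>: "\<And>i. i < m \<Longrightarrow> \<theta> i \<in> M \<rightarrow>\<^sub>M S"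
    using assms(3) unfolding sample_def by blast
  have P': "prob_space (P \<omega>)" "sets (P \<omega>) = sets S" if "\<omega> \<in> space M" for \<omega>
    using measurable_space[OF P that] by (auto simp: space_prob_algebra)
  have M_in: "M \<in> space (prob_algebra M)" by (simp add: space_prob_algebra M)
  have sets_law: "sets (sample_law M P m) = sets (\<Pi>\<^sub>M i\<in>{..<m}. S)"
    unfolding sample_law_def using not_empty P'(2)
    by (intro sets_bind) (auto intro!: sets_PiM_cong)
  have vec: "(\<lambda>\<omega>. \<lambda>i\<in>{..<m}. \<theta> i \<omega>) \<in> M \<rightarrow>\<^sub>M (\<Pi>\<^sub>M i\<in>{..<m}. S)"
    by (intro measurable_restrict \<theta>) auto
  have rect: "emeasure (distr M (\<Pi>\<^sub>M i\<in>{..<m}. S) (\<lambda>\<omega>. \<lambda>i\<in>{..<m}. \<theta> i \<omega>)) (Pi\<^sub>E {..<m} A)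
                = emeasure (sample_law M P m) (Pi\<^sub>E {..<m} A)"
    if A: "\<And>i. i \<in> {..<m} \<Longrightarrow> A i \<in> sets S" for A
  proof -
    define E where "E = {\<omega>\<in>space M. \<forall>i<m. \<theta> i \<omega> \<in> A i}"
    have vimage: "E = (\<lambda>\<omega>. \<lambda>i\<in>{..<m}. \<theta> i \<omega>) -` Pi\<^sub>E {..<m} A \<inter> space M"
      unfolding E_def by (rule box_vimage)
    have box: "Pi\<^sub>E {..<m} A \<in> sets (\<Pi>\<^sub>M i\<in>{..<m}. S)"
      by (rule sets_PiM_I_finite[OF finite_lessThan A])
    have E: "E \<in> sets M"
      unfolding vimage by (rule measurable_sets[OF vec box])
    have int: "integrable M (indicator E :: _ \<Rightarrow> real)"
      by (rule integrable_real_indicator[OF E]) (simp add: emeasure_eq_measure)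
    have prod: "(\<lambda>\<omega>. \<Prod>i<m. measure (P \<omega>) (A i)) \<in> borel_measurable M"
      using A by (intro borel_measurable_prod measurable_compose[OF P measurable_measure_prob_algebra]) auto
    have AE: "AE \<omega> in M. real_cond_exp M ?F (indicator E) \<omega> = (\<Prod>i<m. measure (P \<omega>) (A i))"
      using assms(3) A unfolding sample_def E_def by (meson lessThan_iff)
    have "emeasure (distr M (\<Pi>\<^sub>M i\<in>{..<m}. S) (\<lambda>\<omega>. \<lambda>i\<in>{..<m}. \<theta> i \<omega>)) (Pi\<^sub>E {..<m} A) = emeasure M E"
      unfolding vimage by (rule emeasure_distr[OF vec box])
    also have "\<dots> = ennreal (\<integral>\<omega>. indicator E \<omega> \<partial>M)"
      using E by (simp add: emeasure_eq_measure)
    also have "(\<integral>\<omega>. indicator E \<omega> \<partial>M) = (\<integral>\<omega>. real_cond_exp M ?F (indicator E) \<omega> \<partial>M)"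
      by (rule sigma_finite_subalgebra.real_cond_exp_int(2)[OF sfs int, symmetric])
    also have "\<dots> = (\<integral>\<omega>. (\<Prod>i<m. measure (P \<omega>) (A i)) \<partial>M)"
      by (rule integral_cong_AE[OF borel_measurable_cond_exp2 prod AE])
    also have "ennreal \<dots> = (\<integral>\<^sup>+\<omega>. ennreal (\<Prod>i<m. measure (P \<omega>) (A i)) \<partial>M)"
    proof (rule nn_integral_eq_integral[symmetric])
      show "integrable M (\<lambda>\<omega>. \<Prod>i<m. measure (P \<omega>) (A i))"
      proof (rule integrable_const_bound[where B = 1, OF AE_I2 prod])
        fix \<omega> assume "\<omega> \<in> space M"
        then show "norm (\<Prod>i<m. measure (P \<omega>) (A i)) \<le> 1"
          using P'(1) by (auto simp: abs_prod intro!: prod_le_1 prob_space.prob_le_1)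
      qed
    qed (auto intro!: AE_I2 prod_nonneg)
    also have "\<dots> = (\<integral>\<^sup>+\<omega>. emeasure (\<Pi>\<^sub>M i\<in>{..<m}. P \<omega>) (Pi\<^sub>E {..<m} A) \<partial>M)"
    proof (rule nn_integral_cong)
      fix \<omega> assume \<omega>: "\<omega> \<in> space M"
      interpret Q: prob_space "P \<omega>" by (rule P'(1)[OF \<omega>])
      interpret product_sigma_finite "\<lambda>_::nat. P \<omega>" ..
      show "ennreal (\<Prod>i<m. measure (P \<omega>) (A i)) = emeasure (\<Pi>\<^sub>M i\<in>{..<m}. P \<omega>) (Pi\<^sub>E {..<m} A)"
        using A P'(2)[OF \<omega>] by (subst emeasure_PiM) (auto simp: Q.emeasure_eq_measure prod_ennreal)
    qed
    also have "\<dots> = emeasure (sample_law M P m) (Pi\<^sub>E {..<m} A)"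
      unfolding sample_law_def using A
      by (intro emeasure_bind_prob_algebra[OF M_in measurable_sample_kernel[OF P], symmetric]
          sets_PiM_I_finite) auto
    finally show ?thesis .
  qed
  interpret D: prob_space "distr M (\<Pi>\<^sub>M i\<in>{..<m}. S) (\<lambda>\<omega>. \<lambda>i\<in>{..<m}. \<theta> i \<omega>)"
    by (rule prob_space_distr[OF vec])
  show ?thesis
  proof (rule measure_eqI_PiM_finite[OF finite_lessThan _ sets_law rect])
    show "range (\<lambda>_::nat. \<Pi>\<^sub>E i\<in>{..<m}. space S) \<subseteq> prod_algebra {..<m} (\<lambda>_. S)"
      by (auto intro!: prod_algebraI_finite)
  qed (simp_all add: space_PiM)
qed


section \<open>Ties in a sample\<close>

definition num_distinct :: "nat \<Rightarrow> (nat \<Rightarrow> 'a) \<Rightarrow> nat" where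
  "num_distinct m \<theta> = card (\<theta> ` {..<m})"

definition ties_partition :: "nat \<Rightarrow> (nat \<Rightarrow> 'a) \<Rightarrow> nat set set" where
  "ties_partition n \<theta> = {..<n} // {(i, j). i < n \<and> j < n \<and> \<theta> i = \<theta> j}"

text \<open>The eppf is evaluated at the partition into consecutive blocks of the given sizes; the
  sample being exchangeable, every partition with these block sizes has the same probability.\<close>

definition consecutive_partition :: "nat list \<Rightarrow> nat set set" where
  "consecutive_partition ns =
     (\<lambda>l. {sum_list (take l ns)..<sum_list (take (Suc l) ns)}) ` {..<length ns}"

definition eppf :: "'w measure \<Rightarrow> ('w \<Rightarrow> 'a measure) \<Rightarrow> nat list \<Rightarrow> real" where
  "eppf M P ns =
     (let n = sum_list ns in
      measure (sample_law M P n)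
        {\<theta> \<in> space (sample_law M P n). ties_partition n \<theta> = consecutive_partition ns})"

end

theory Submission
  imports Defs
begin

text \<open>All three claims are instances of one identity for mixed moments, \<open>mixed_moment_eq_ties\<close>:
  \<open>E(P(A 0) \<cdots> P(A (m - 1)))\<close> is the expectation, over a sample of size \<open>m\<close>, of the product
  over the blocks \<open>C\<close> of the partition by ties of \<open>P0(\<Inter>i\<in>C. A i)\<close>. It says that, given the
  partition by ties, the distinct sample values are iid from \<open>P0\<close>. With \<open>A i = B\<close> the product is
  \<open>P0(B)\<close> to the number of blocks, which is the moment formula. With \<open>m = 2\<close> the partition has
  one block with probability \<open>p(2)\<close> and two blocks otherwise, which gives the covariance, and the
  variance is the covariance for \<open>B1 = B2\<close>.

  The identity holds because \<open>P\<close> is discrete. A sample is obtained by drawing an index map \<open>g\<close>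
  with probability \<open>\<Prod>i. J (g i) / T\<close> and reading off the locations \<open>\<tau> (g i)\<close>
  (\<open>nn_integral_PiM_normalized_atoms\<close>). Given \<open>N = n\<close> the locations are independent of the
  jumps, so it suffices to compare the expectations over the locations for every fixed \<open>g\<close>
  (\<open>nn_integral_sample_law_eqI\<close>). Since \<open>P0\<close> has no atoms, the locations are almost surely
  distinct; hence the ties of the sample are those of \<open>g\<close>, and independence factorizes the
  probability over the fibres of \<open>g\<close> (\<open>nn_integral_locations\<close>). The laws of \<open>N\<close> and of the
  jumps enter only through the weights.\<close>


section \<open>The partition generated by ties\<close>

text \<open>Describing the blocks as the fibres of \<open>\<theta>\<close> over its values makes counting blocks and
  reindexing products over blocks immediate.\<close>

lemma ties_partition_eq_fibres:
  "ties_partition m \<theta> = (\<lambda>x. {i. i < m \<and> \<theta> i = x}) ` \<theta> ` {..<m}"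
proof -
  have "{(i, j). i < m \<and> j < m \<and> \<theta> i = \<theta> j} `` {i} = {k. k < m \<and> \<theta> k = \<theta> i}" if "i < m" for i
    using that by auto
  then show ?thesis
    by (auto simp: ties_partition_def quotient_def image_image intro!: image_eqI)
qed

lemma inj_on_fibres: "inj_on (\<lambda>x. {i. i < m \<and> \<theta> i = x}) (\<theta> ` {..<m::nat})"
  by (rule inj_onI) (fastforce simp: set_eq_iff)

lemma card_ties_partition: "card (ties_partition m \<theta>) = num_distinct m \<theta>"
  unfolding ties_partition_eq_fibres num_distinct_def by (rule card_image[OF inj_on_fibres])

lemma prod_ties_partition:
  "(\<Prod>C\<in>ties_partition m \<theta>. f C) = (\<Prod>x\<in>\<theta> ` {..<m}. f {i. i < m \<and> \<theta> i = x})"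
  unfolding ties_partition_eq_fibres by (subst prod.reindex[OF inj_on_fibres]) simp

lemma ties_partition_comp:
  assumes "inj_on t (g ` {..<m})"
  shows "ties_partition m (\<lambda>i\<in>{..<m}. t (g i)) = ties_partition m g"
proof -
  have "{(i, j). i < m \<and> j < m \<and> (\<lambda>i\<in>{..<m}. t (g i)) i = (\<lambda>i\<in>{..<m}. t (g i)) j}
      = {(i, j). i < m \<and> j < m \<and> g i = g j}"
    using inj_onD[OF assms] by (fastforce simp: image_iff)
  then show ?thesis unfolding ties_partition_def by simp
qed

lemma ties_partition_2:
  "ties_partition 2 \<theta> = (if \<theta> 0 = \<theta> 1 then {{0, 1}} else {{0}, {1}})"
proof -
  have "{i. i < 2 \<and> \<theta> i = x} = (if \<theta> 0 = x then {0} else {}) \<union> (if \<theta> 1 = x then {1::nat} else {})"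
    for x by (auto dest!: less_2_cases)
  moreover have "{..<2} = {0, 1::nat}" by auto
  ultimately show ?thesis
    by (simp add: ties_partition_eq_fibres insert_commute)
qed

lemma consecutive_partition_2: "consecutive_partition [2] = {{0, 1}}"
proof -
  have "{0..<2} = {0, 1::nat}" by auto
  then show ?thesis by (simp add: consecutive_partition_def lessThan_Suc)
qed


section \<open>Samples from a discrete measure\<close>

text \<open>An iid sample from a measure with atoms \<open>\<tau> 0, \<dots>, \<tau> n\<close> is obtained by drawing the
  indices \<open>g i\<close> of the atoms. The two laws agree on rectangles because a product of sums over
  \<open>{..n}\<close> expands into a sum over all index maps.\<close>

lemma PiM_normalized_atoms:
  fixes \<tau> :: "nat \<Rightarrow> 'a"
  assumes J: "\<And>j. j \<le> n \<Longrightarrow> 0 < J j" and \<tau>: "\<And>j. j \<le> n \<Longrightarrow> \<tau> j \<in> space S"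
  shows "(\<Pi>\<^sub>M i\<in>{..<m::nat}. normalized_atoms S n J \<tau>) =
    distr (density (count_space ({..<m} \<rightarrow>\<^sub>E {..n}))
        (\<lambda>g. \<Prod>i<m. ennreal (J (g i) / (\<Sum>j\<le>n. J j))))
      (\<Pi>\<^sub>M i\<in>{..<m}. S) (\<lambda>g. \<lambda>i\<in>{..<m}. \<tau> (g i))"
    (is "_ = distr (density (count_space ?G) ?w) _ ?h")
proof -
  let ?Q = "normalized_atoms S n J \<tau>"
  interpret Q: prob_space ?Q by (rule prob_space_normalized_atoms[OF J \<tau>])
  interpret product_sigma_finite "\<lambda>_::nat. ?Q" ..
  have fin: "finite ?G" by (intro finite_PiE) auto
  have h: "?h \<in> density (count_space ?G) ?w \<rightarrow>\<^sub>M (\<Pi>\<^sub>M i\<in>{..<m}. S)"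
    using \<tau> by (auto simp: space_PiM measurable_def PiE_iff)
  show ?thesis
  proof (rule PiM_eqI[symmetric])
    show "sets (distr (density (count_space ?G) ?w) (\<Pi>\<^sub>M i\<in>{..<m}. S) ?h)
        = sets (\<Pi>\<^sub>M i\<in>{..<m}. ?Q)"
      by (simp cong: sets_PiM_cong)
  next
    fix A assume "\<And>i. i \<in> {..<m} \<Longrightarrow> A i \<in> sets ?Q"
    then have A: "A i \<in> sets S" if "i < m" for i using that by simp
    have "emeasure (distr (density (count_space ?G) ?w) (\<Pi>\<^sub>M i\<in>{..<m}. S) ?h) (Pi\<^sub>E {..<m} A)
        = (\<integral>\<^sup>+g. ?w g * indicator (?h -` Pi\<^sub>E {..<m} A \<inter> ?G) g \<partial>count_space ?G)"
      using A by (subst emeasure_distr[OF h])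
        (auto simp: emeasure_density intro!: sets_PiM_I_finite)
    also have "\<dots> = (\<Sum>g\<in>?G. \<Prod>i<m. ennreal (J (g i) / (\<Sum>j\<le>n. J j)) * indicator (A i) (\<tau> (g i)))"
      unfolding nn_integral_count_space_finite[OF fin]
    proof (rule sum.cong[OF refl])
      fix g assume g: "g \<in> ?G"
      have "indicator (?h -` Pi\<^sub>E {..<m} A \<inter> ?G) g = (\<Prod>i<m. indicator (A i) (\<tau> (g i)) :: ennreal)"
      proof (cases "\<forall>i<m. \<tau> (g i) \<in> A i")
        case True
        with g show ?thesis by (auto simp: indicator_def)
      next
        case False
        then obtain i where i: "i < m" "\<tau> (g i) \<notin> A i" by auto
        then have "(\<Prod>i<m. indicator (A i) (\<tau> (g i)) :: ennreal) = 0"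
          by (intro prod_zero) (auto intro!: bexI[of _ i])
        moreover have "?h g \<notin> Pi\<^sub>E {..<m} A" using i by (auto simp: PiE_iff)
        ultimately show ?thesis by simp
      qed
      then show "?w g * indicator (?h -` Pi\<^sub>E {..<m} A \<inter> ?G) g
          = (\<Prod>i<m. ennreal (J (g i) / (\<Sum>j\<le>n. J j)) * indicator (A i) (\<tau> (g i)))"
        by (simp add: prod.distrib)
    qed
    also have "\<dots> = (\<Prod>i<m. \<Sum>j\<le>n. ennreal (J j / (\<Sum>j\<le>n. J j)) * indicator (A i) (\<tau> j))"
      by (rule prod_sum_PiE[symmetric]) auto
    also have "\<dots> = (\<Prod>i<m. emeasure ?Q (A i))"
      using A by (intro prod.cong refl emeasure_normalized_atoms[symmetric]) auto
    finally show "emeasure (distr (density (count_space ?G) ?w) (\<Pi>\<^sub>M i\<in>{..<m}. S) ?h) (Pi\<^sub>E {..<m} A)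
        = (\<Prod>i\<in>{..<m}. emeasure ?Q (A i))" by simp
  qed simp
qed

lemma nn_integral_PiM_normalized_atoms:
  fixes \<tau> :: "nat \<Rightarrow> 'a"
  assumes "\<And>j. j \<le> n \<Longrightarrow> 0 < J j" "\<And>j. j \<le> n \<Longrightarrow> \<tau> j \<in> space S"
    and F: "F \<in> borel_measurable (\<Pi>\<^sub>M i\<in>{..<m::nat}. S)"
  shows "(\<integral>\<^sup>+\<theta>. F \<theta> \<partial>(\<Pi>\<^sub>M i\<in>{..<m}. normalized_atoms S n J \<tau>)) =
    (\<Sum>g\<in>{..<m} \<rightarrow>\<^sub>E {..n}. (\<Prod>i<m. ennreal (J (g i) / (\<Sum>j\<le>n. J j))) * F (\<lambda>i\<in>{..<m}. \<tau> (g i)))"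
proof -
  have h: "(\<lambda>g. \<lambda>i\<in>{..<m}. \<tau> (g i)) \<in> density (count_space ({..<m} \<rightarrow>\<^sub>E {..n}))
      (\<lambda>g. \<Prod>i<m. ennreal (J (g i) / (\<Sum>j\<le>n. J j))) \<rightarrow>\<^sub>M (\<Pi>\<^sub>M i\<in>{..<m}. S)"
    using assms(2) by (auto simp: space_PiM measurable_def PiE_iff)
  show ?thesis
    by (subst PiM_normalized_atoms[OF assms(1,2)])
      (simp_all add: nn_integral_distr[OF h] F nn_integral_density nn_integral_count_space_finite finite_PiE)
qed


section \<open>Locations drawn from a diffuse measure\<close>

text \<open>Measurability of the diagonal makes "two sample values coincide" an event.\<close>

locale diffuse_prob_space = prob_space S for S :: "'a measure" +
  assumes diagonal: "Measurable.pred (S \<Otimes>\<^sub>M S) (\<lambda>(x, y). x = y)"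
    and singleton_null: "\<And>x. emeasure S {x} = 0"
begin

lemma measurable_ties_partition [measurable]:
  "ties_partition m \<in> (\<Pi>\<^sub>M i\<in>{..<m}. S) \<rightarrow>\<^sub>M count_space UNIV"
proof -
  let ?R = "\<lambda>\<theta>::nat \<Rightarrow> 'a. {(i, j). i < m \<and> j < m \<and> \<theta> i = \<theta> j}"
  let ?A = "Pow ({..<m} \<times> {..<m})"
  have eq [measurable]: "Measurable.pred (\<Pi>\<^sub>M i\<in>{..<m}. S) (\<lambda>\<theta>. \<theta> i = \<theta> j)" if "i < m" "j < m" for i j
  proof -
    have "(\<lambda>\<theta>. (\<theta> i, \<theta> j)) \<in> (\<Pi>\<^sub>M i\<in>{..<m}. S) \<rightarrow>\<^sub>M S \<Otimes>\<^sub>M S"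
      using that by (intro measurable_Pair measurable_component_singleton) auto
    from measurable_compose[OF this diagonal] show ?thesis by simp
  qed
  \<comment> \<open>the relation of ties takes finitely many values\<close>
  have "?R \<in> (\<Pi>\<^sub>M i\<in>{..<m}. S) \<rightarrow>\<^sub>M count_space ?A"
  proof (subst measurable_count_space_eq2, simp, intro conjI ballI)
    fix r assume r: "r \<in> ?A"
    have "?R -` {r} \<inter> space (\<Pi>\<^sub>M i\<in>{..<m}. S) =
        {\<theta>\<in>space (\<Pi>\<^sub>M i\<in>{..<m}. S). \<forall>i\<in>{..<m}. \<forall>j\<in>{..<m}. (\<theta> i = \<theta> j) = ((i, j) \<in> r)}"
      using r by (auto simp: set_eq_iff)
    also have "\<dots> \<in> sets (\<Pi>\<^sub>M i\<in>{..<m}. S)"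
      by measurable
    finally show "?R -` {r} \<inter> space (\<Pi>\<^sub>M i\<in>{..<m}. S) \<in> sets (\<Pi>\<^sub>M i\<in>{..<m}. S)" .
  qed auto
  moreover have "(\<lambda>r. {..<m} // r) \<in> count_space ?A \<rightarrow>\<^sub>M count_space UNIV" by simp
  ultimately show ?thesis
    unfolding ties_partition_def[abs_def] by (rule measurable_compose)
qed

text \<open>Fix all coordinates but the \<open>i\<close>-th: the \<open>i\<close>-th one hits the value of the \<open>j\<close>-th with
  probability zero.\<close>

lemma AE_PiM_neq:
  assumes "finite I" "i \<in> I" "j \<in> I" "i \<noteq> j"
  shows "AE t in (\<Pi>\<^sub>M k\<in>I. S). t i \<noteq> t j"
proof -
  interpret product_sigma_finite "\<lambda>_. S" ..
  let ?K = "I - {i}"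
  have I: "insert i ?K = I" using assms by auto
  have pred: "Measurable.pred (\<Pi>\<^sub>M k\<in>I. S) (\<lambda>t. t i = t j)"
  proof -
    have "(\<lambda>t. (t i, t j)) \<in> (\<Pi>\<^sub>M k\<in>I. S) \<rightarrow>\<^sub>M S \<Otimes>\<^sub>M S"
      using assms by (intro measurable_Pair measurable_component_singleton) auto
    from measurable_compose[OF this diagonal] show ?thesis by simp
  qed
  let ?D = "{t\<in>space (\<Pi>\<^sub>M k\<in>I. S). t i = t j}"
  have D: "?D \<in> sets (\<Pi>\<^sub>M k\<in>I. S)" using pred by measurable
  have "emeasure (\<Pi>\<^sub>M k\<in>I. S) ?D = (\<integral>\<^sup>+t. indicator ?D t \<partial>(\<Pi>\<^sub>M k\<in>insert i ?K. S))"
    using D I by simp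
  also have "\<dots> = (\<integral>\<^sup>+t. \<integral>\<^sup>+y. indicator ?D (t(i := y)) \<partial>S \<partial>(\<Pi>\<^sub>M k\<in>?K. S))"
    by (rule product_nn_integral_insert) (use assms(1) D I in auto)
  also have "\<dots> = (\<integral>\<^sup>+t. 0 \<partial>(\<Pi>\<^sub>M k\<in>?K. S))"
  proof (rule nn_integral_cong)
    fix t assume "t \<in> space (\<Pi>\<^sub>M k\<in>?K. S)"
    have "(\<integral>\<^sup>+y. indicator ?D (t(i := y)) \<partial>S) \<le> (\<integral>\<^sup>+y. indicator {t j} y \<partial>S)"
      using assms by (intro nn_integral_mono) (auto simp: indicator_def)
    also have "\<dots> = 0"
    proof (cases "{t j} \<in> sets S")
      case True
      then show ?thesis by (simp add: singleton_null)
    next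
      case False
      \<comment> \<open>points of the space have measurable singletons, being sections of the diagonal\<close>
      have "t j \<notin> space S"
      proof
        assume "t j \<in> space S"
        then have "(\<lambda>y. (t j, y)) \<in> S \<rightarrow>\<^sub>M S \<Otimes>\<^sub>M S" by measurable
        from measurable_compose[OF this diagonal]
        have "Measurable.pred S (\<lambda>y. t j = y)" by simp
        then have "{y\<in>space S. t j = y} \<in> sets S" by (rule predE)
        moreover have "{y\<in>space S. t j = y} = {t j}" using \<open>t j \<in> space S\<close> by auto
        ultimately show False using False by simp
      qed
      then have "(\<integral>\<^sup>+y. indicator {t j} y \<partial>S) = (\<integral>\<^sup>+y. 0 \<partial>S)"
        by (intro nn_integral_cong) (auto simp: indicator_def)
      then show ?thesis by simp
    qed
    finally show "(\<integral>\<^sup>+y. indicator ?D (t(i := y)) \<partial>S) = 0" by simp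
  qed
  finally have "emeasure (\<Pi>\<^sub>M k\<in>I. S) ?D = 0" by simp
  then show ?thesis
    using D by (intro AE_I[of _ _ ?D]) auto
qed

lemma AE_PiM_inj_on:
  assumes "finite I"
  shows "AE t in (\<Pi>\<^sub>M k\<in>I. S). inj_on t I"
proof -
  have "AE t in (\<Pi>\<^sub>M k\<in>I. S). \<forall>i\<in>I. \<forall>j\<in>I - {i}. t i \<noteq> t j"
    using assms by (intro AE_finite_allI AE_PiM_neq) auto
  then show ?thesis by eventually_elim (auto simp: inj_on_def)
qed

text \<open>For a fixed index map \<open>g\<close>, independence factorizes the left side over the atoms that are
  used, that is, over the fibres of \<open>g\<close>. The locations being distinct, these fibres are the
  blocks of ties of the sample.\<close>

lemma nn_integral_locations:
  fixes m n :: nat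
  assumes g: "g \<in> {..<m} \<rightarrow> {..n}" and A: "\<And>i. i < m \<Longrightarrow> A i \<in> sets S"
  shows "(\<integral>\<^sup>+t. indicator (Pi\<^sub>E {..<m} A) (\<lambda>i\<in>{..<m}. t (g i)) \<partial>(\<Pi>\<^sub>M j\<in>{..n}. S)) =
    (\<integral>\<^sup>+t. (\<Prod>C\<in>ties_partition m (\<lambda>i\<in>{..<m}. t (g i)). emeasure S (\<Inter>i\<in>C. A i)) \<partial>(\<Pi>\<^sub>M j\<in>{..n}. S))"
    (is "?l = ?r")
proof -
  interpret product_sigma_finite "\<lambda>_::nat. S" ..
  interpret T: prob_space "\<Pi>\<^sub>M j\<in>{..n}. S" by (intro prob_space_PiM prob_space_axioms)
  define B where "B j = space S \<inter> (\<Inter>i\<in>{i. i < m \<and> g i = j}. A i)" for j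
  have B: "B j \<in> sets S" for j
  proof (cases "{i. i < m \<and> g i = j} = {}")
    case True
    then show ?thesis unfolding B_def True by simp
  next
    case False
    then show ?thesis unfolding B_def
      using A by (intro sets.Int sets.top sets.finite_INT) auto
  qed
  have "?l = (\<integral>\<^sup>+t. indicator (Pi\<^sub>E {..n} B) t \<partial>(\<Pi>\<^sub>M j\<in>{..n}. S))"
  proof (rule nn_integral_cong)
    fix t assume "t \<in> space (\<Pi>\<^sub>M j\<in>{..n}. S)"
    then have "(\<lambda>i\<in>{..<m}. t (g i)) \<in> Pi\<^sub>E {..<m} A \<longleftrightarrow> t \<in> Pi\<^sub>E {..n} B"
      using g by (auto simp: space_PiM PiE_iff B_def)
    then show "indicator (Pi\<^sub>E {..<m} A) (\<lambda>i\<in>{..<m}. t (g i)) = (indicator (Pi\<^sub>E {..n} B) t :: ennreal)"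
      by (simp add: indicator_def)
  qed
  also have "\<dots> = (\<Prod>j\<le>n. emeasure S (B j))"
  proof -
    have "Pi\<^sub>E {..n} B \<in> sets (\<Pi>\<^sub>M j\<in>{..n}. S)" by (intro sets_PiM_I_finite B) auto
    then show ?thesis using emeasure_PiM[of "{..n}" B] B by simp
  qed
  also have "\<dots> = (\<Prod>j\<in>g ` {..<m}. emeasure S (B j))"
  proof (rule prod.mono_neutral_right)
    show "\<forall>j\<in>{..n} - g ` {..<m}. emeasure S (B j) = 1"
    proof
      fix j assume "j \<in> {..n} - g ` {..<m}"
      then have "B j = space S" by (auto simp: B_def)
      then show "emeasure S (B j) = 1" by (simp add: emeasure_space_1)
    qed
  qed (use g in auto)
  also have "\<dots> = (\<Prod>j\<in>g ` {..<m}. emeasure S (\<Inter>i\<in>{i. i < m \<and> g i = j}. A i))"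
  proof (intro prod.cong refl arg_cong2[where f = emeasure])
    fix j assume "j \<in> g ` {..<m}"
    then show "B j = (\<Inter>i\<in>{i. i < m \<and> g i = j}. A i)"
      using A[THEN sets.sets_into_space] by (auto simp: B_def)
  qed
  also have "\<dots> = (\<Prod>C\<in>ties_partition m g. emeasure S (\<Inter>i\<in>C. A i))"
    by (rule prod_ties_partition[symmetric])
  also have "\<dots> = (\<integral>\<^sup>+t. (\<Prod>C\<in>ties_partition m g. emeasure S (\<Inter>i\<in>C. A i)) \<partial>(\<Pi>\<^sub>M j\<in>{..n}. S))"
    by (simp add: T.emeasure_space_1)
  also have "\<dots> = ?r"
  proof (rule nn_integral_cong_AE)
    show "AE t in (\<Pi>\<^sub>M j\<in>{..n}. S). (\<Prod>C\<in>ties_partition m g. emeasure S (\<Inter>i\<in>C. A i))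
        = (\<Prod>C\<in>ties_partition m (\<lambda>i\<in>{..<m}. t (g i)). emeasure S (\<Inter>i\<in>C. A i))"
      using AE_PiM_inj_on[OF finite_atMost[of n]]
    proof eventually_elim
      case (elim t)
      then have "inj_on t (g ` {..<m})" using g by (auto intro: inj_on_subset)
      then show ?case by (simp only: ties_partition_comp)
    qed
  qed
  finally show ?thesis .
qed


section \<open>Mixed moments and ties\<close>

text \<open>Given \<open>N = n\<close>, an integral against the sample law is a sum over index maps \<open>g\<close> of a weight
  depending on the jumps only times an integral over the independent locations. Hence only the
  integrals over the locations have to be compared, whatever the laws of \<open>N\<close> and of the jumps.\<close>

lemma nn_integral_sample_law_eqI:
  fixes \<tau> :: "nat \<Rightarrow> 'w \<Rightarrow> 'a"
  assumes M: "prob_space M"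
    and V: "eps_NormCRM_variables \<rho> \<kappa> S \<epsilon> M N J \<tau>"
    and P: "\<And>\<omega>. \<omega> \<in> space M \<Longrightarrow> P \<omega> = normalized_atoms S (N \<omega>) (\<lambda>j. J j \<omega>) (\<lambda>j. \<tau> j \<omega>)"
    and F: "F \<in> borel_measurable (\<Pi>\<^sub>M i\<in>{..<m}. S)" and F': "F' \<in> borel_measurable (\<Pi>\<^sub>M i\<in>{..<m}. S)"
    and eq: "\<And>(n::nat) g. g \<in> {..<m} \<rightarrow> {..n} \<Longrightarrow>
      (\<integral>\<^sup>+t. F (\<lambda>i\<in>{..<m}. t (g i)) \<partial>(\<Pi>\<^sub>M j\<in>{..n}. S)) = (\<integral>\<^sup>+t. F' (\<lambda>i\<in>{..<m}. t (g i)) \<partial>(\<Pi>\<^sub>M j\<in>{..n}. S))"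
  shows "(\<integral>\<^sup>+\<theta>. F \<theta> \<partial>sample_law M P m) = (\<integral>\<^sup>+\<theta>. F' \<theta> \<partial>sample_law M P m)"
proof -
  interpret M: prob_space M by (rule M)
  have "eps_NormCRM \<rho> \<kappa> S \<epsilon> M P"
    using V P unfolding eps_NormCRM_def by blast
  from measurable_prob_algebraD[OF measurable_sample_kernel[OF measurable_eps_NormCRM[OF this]]]
  have K: "(\<lambda>\<omega>. \<Pi>\<^sub>M i\<in>{..<m}. P \<omega>) \<in> M \<rightarrow>\<^sub>M subprob_algebra (\<Pi>\<^sub>M i\<in>{..<m}. S)" .
  have N [measurable]: "N \<in> M \<rightarrow>\<^sub>M count_space UNIV"
    and J [measurable]: "\<And>j. J j \<in> M \<rightarrow>\<^sub>M borel" and \<tau> [measurable]: "\<And>j. \<tau> j \<in> M \<rightarrow>\<^sub>M S"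
    and pos: "\<And>\<omega> j. \<omega> \<in> space M \<Longrightarrow> j \<le> N \<omega> \<Longrightarrow> 0 < J j \<omega>"
    and law: "\<And>n. distr (uniform_measure M {\<omega>\<in>space M. N \<omega> = n})
            ((\<Pi>\<^sub>M j\<in>{..n}. borel) \<Otimes>\<^sub>M (\<Pi>\<^sub>M j\<in>{..n}. S))
            (\<lambda>\<omega>. (\<lambda>j\<in>{..n}. J j \<omega>, \<lambda>j\<in>{..n}. \<tau> j \<omega>))
          = (\<Pi>\<^sub>M j\<in>{..n}. density lborel (\<lambda>s. ennreal (rho_eps \<rho> \<kappa> \<epsilon> s))) \<Otimes>\<^sub>M (\<Pi>\<^sub>M j\<in>{..n}. S)"
    using V unfolding eps_NormCRM_variables_def by auto
  define E where "E F \<omega> = (\<integral>\<^sup>+\<theta>. F \<theta> \<partial>(\<Pi>\<^sub>M i\<in>{..<m}. P \<omega>))" for F \<omega>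
  define w where "w n x g = (\<Prod>i<m. ennreal (x (g i) / (\<Sum>j\<le>n. x j)))"
    for n and x :: "nat \<Rightarrow> real" and g :: "nat \<Rightarrow> nat"
  define L where "L n = (\<Pi>\<^sub>M j\<in>{..n}. density lborel (\<lambda>s. ennreal (rho_eps \<rho> \<kappa> \<epsilon> s)))" for n :: nat
  define A where "A n = {\<omega>\<in>space M. N \<omega> = n}" for n
  have A [measurable]: "A n \<in> sets M" for n unfolding A_def by measurable
  have sets_L: "sets (L n) = sets (\<Pi>\<^sub>M j\<in>{..n}. borel)" for n
    unfolding L_def by (intro sets_PiM_cong) auto
  have E_meas: "E F \<in> borel_measurable M" if "F \<in> borel_measurable (\<Pi>\<^sub>M i\<in>{..<m}. S)" for F
    unfolding E_def
    by (rule measurable_compose[OF K nn_integral_measurable_subprob_algebra[OF that]])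
  have w_meas: "(\<lambda>x. w n x g) \<in> borel_measurable (\<Pi>\<^sub>M j\<in>{..n}. borel)" if "g \<in> {..<m} \<rightarrow>\<^sub>E {..n}" for n g
    unfolding w_def using that
    by (intro borel_measurable_prod_ennreal measurable_compose[OF _ measurable_ennreal]
        borel_measurable_divide borel_measurable_sum measurable_component_singleton) auto
  have F_meas: "(\<lambda>t. F (\<lambda>i\<in>{..<m}. t (g i))) \<in> borel_measurable (\<Pi>\<^sub>M j\<in>{..n}. S)"
    if "g \<in> {..<m} \<rightarrow>\<^sub>E {..n}" "F \<in> borel_measurable (\<Pi>\<^sub>M i\<in>{..<m}. S)" for F :: "_ \<Rightarrow> ennreal" and n g
    using that(1)
    by (intro measurable_compose[OF measurable_restrict that(2)] measurable_component_singleton) auto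
  have cond: "(\<integral>\<^sup>+\<omega>. E F \<omega> * indicator (A n) \<omega> \<partial>M) / emeasure M (A n) =
      (\<integral>\<^sup>+x. (\<Sum>g\<in>{..<m} \<rightarrow>\<^sub>E {..n}. w n x g *
         (\<integral>\<^sup>+t. F (\<lambda>i\<in>{..<m}. t (g i)) \<partial>(\<Pi>\<^sub>M j\<in>{..n}. S))) \<partial>L n)"
    if F: "F \<in> borel_measurable (\<Pi>\<^sub>M i\<in>{..<m}. S)" for F n
  proof -
    interpret T: prob_space "\<Pi>\<^sub>M j\<in>{..n}. S" by (intro prob_space_PiM prob_space_axioms)
    let ?B = "(\<Pi>\<^sub>M j\<in>{..n}. borel :: real measure) \<Otimes>\<^sub>M (\<Pi>\<^sub>M j\<in>{..n}. S)"
    let ?X = "\<lambda>\<omega>. (\<lambda>j\<in>{..n}. J j \<omega>, \<lambda>j\<in>{..n}. \<tau> j \<omega>)"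
    define H where "H = (\<lambda>(x, t). \<Sum>g\<in>{..<m} \<rightarrow>\<^sub>E {..n}. w n x g * F (\<lambda>i\<in>{..<m}. t (g i)))"
    have X [measurable]: "?X \<in> M \<rightarrow>\<^sub>M ?B"
      by (intro measurable_Pair measurable_restrict J \<tau>)
    have H [measurable]: "H \<in> borel_measurable ?B"
      unfolding H_def split_beta
      by (intro borel_measurable_sum borel_measurable_times_ennreal
          measurable_compose[OF measurable_fst w_meas] measurable_compose[OF measurable_snd F_meas] F)
    have H_L: "H \<in> borel_measurable (L n \<Otimes>\<^sub>M (\<Pi>\<^sub>M j\<in>{..n}. S))"
      using H by (simp add: measurable_cong_sets[OF sets_pair_measure_cong[OF sets_L refl] refl])
    have "(\<integral>\<^sup>+\<omega>. E F \<omega> * indicator (A n) \<omega> \<partial>M) = (\<integral>\<^sup>+\<omega>. H (?X \<omega>) * indicator (A n) \<omega> \<partial>M)"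
    proof (rule nn_integral_cong)
      fix \<omega> assume \<omega>: "\<omega> \<in> space M"
      show "E F \<omega> * indicator (A n) \<omega> = H (?X \<omega>) * indicator (A n) \<omega>"
      proof (cases "N \<omega> = n")
        case True
        have "E F \<omega> = (\<Sum>g\<in>{..<m} \<rightarrow>\<^sub>E {..n}. w n (\<lambda>j. J j \<omega>) g * F (\<lambda>i\<in>{..<m}. \<tau> (g i) \<omega>))"
          unfolding E_def P[OF \<omega>] True w_def
          using pos[OF \<omega>] True measurable_space[OF \<tau> \<omega>]
          by (intro nn_integral_PiM_normalized_atoms F) auto
        also have "\<dots> = H (?X \<omega>)"
          unfolding H_def split_beta fst_conv snd_conv
        proof (rule sum.cong[OF refl])
          fix g assume g: "g \<in> {..<m} \<rightarrow>\<^sub>E {..n}"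
          then have le: "g i \<le> n" if "i < m" for i using that by auto
          have "w n (\<lambda>j. J j \<omega>) g = w n (\<lambda>j\<in>{..n}. J j \<omega>) g"
            unfolding w_def by (intro prod.cong refl) (simp add: le)
          moreover have "(\<lambda>i\<in>{..<m}. \<tau> (g i) \<omega>) = (\<lambda>i\<in>{..<m}. (\<lambda>j\<in>{..n}. \<tau> j \<omega>) (g i))"
            by (auto simp: le restrict_def)
          ultimately show "w n (\<lambda>j. J j \<omega>) g * F (\<lambda>i\<in>{..<m}. \<tau> (g i) \<omega>) =
            w n (\<lambda>j\<in>{..n}. J j \<omega>) g * F (\<lambda>i\<in>{..<m}. (\<lambda>j\<in>{..n}. \<tau> j \<omega>) (g i))" by simp
        qed
        finally show ?thesis by simp
      qed (simp add: A_def)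
    qed
    then have "(\<integral>\<^sup>+\<omega>. E F \<omega> * indicator (A n) \<omega> \<partial>M) / emeasure M (A n)
        = (\<integral>\<^sup>+\<omega>. H (?X \<omega>) \<partial>uniform_measure M (A n))"
      by (simp add: nn_integral_uniform_measure)
    also have "\<dots> = (\<integral>\<^sup>+z. H z \<partial>distr (uniform_measure M (A n)) ?B ?X)"
      by (rule nn_integral_distr[symmetric]) (simp_all add: measurable_cong_sets[OF sets_uniform_measure refl])
    also have "\<dots> = (\<integral>\<^sup>+z. H z \<partial>(L n \<Otimes>\<^sub>M (\<Pi>\<^sub>M j\<in>{..n}. S)))"
      unfolding A_def law L_def ..
    also have "\<dots> = (\<integral>\<^sup>+x. \<integral>\<^sup>+t. H (x, t) \<partial>(\<Pi>\<^sub>M j\<in>{..n}. S) \<partial>L n)"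
      by (rule T.nn_integral_fst[OF H_L, symmetric])
    also have "\<dots> = (\<integral>\<^sup>+x. (\<Sum>g\<in>{..<m} \<rightarrow>\<^sub>E {..n}. w n x g *
         (\<integral>\<^sup>+t. F (\<lambda>i\<in>{..<m}. t (g i)) \<partial>(\<Pi>\<^sub>M j\<in>{..n}. S))) \<partial>L n)"
    proof (rule nn_integral_cong)
      fix x
      have "(\<integral>\<^sup>+t. H (x, t) \<partial>(\<Pi>\<^sub>M j\<in>{..n}. S)) = (\<Sum>g\<in>{..<m} \<rightarrow>\<^sub>E {..n}.
          \<integral>\<^sup>+t. w n x g * F (\<lambda>i\<in>{..<m}. t (g i)) \<partial>(\<Pi>\<^sub>M j\<in>{..n}. S))"
        unfolding H_def split_beta fst_conv snd_conv
        by (intro nn_integral_sum borel_measurable_times_ennreal measurable_const F_meas F) auto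
      also have "\<dots> = (\<Sum>g\<in>{..<m} \<rightarrow>\<^sub>E {..n}. w n x g *
          (\<integral>\<^sup>+t. F (\<lambda>i\<in>{..<m}. t (g i)) \<partial>(\<Pi>\<^sub>M j\<in>{..n}. S)))"
        by (intro sum.cong refl nn_integral_cmult F_meas F)
      finally show "(\<integral>\<^sup>+t. H (x, t) \<partial>(\<Pi>\<^sub>M j\<in>{..n}. S)) = (\<Sum>g\<in>{..<m} \<rightarrow>\<^sub>E {..n}.
          w n x g * (\<integral>\<^sup>+t. F (\<lambda>i\<in>{..<m}. t (g i)) \<partial>(\<Pi>\<^sub>M j\<in>{..n}. S)))" .
    qed
    finally show ?thesis .
  qed
  have slice: "(\<integral>\<^sup>+\<omega>. E F \<omega> * indicator (A n) \<omega> \<partial>M) = (\<integral>\<^sup>+\<omega>. E F' \<omega> * indicator (A n) \<omega> \<partial>M)" for n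
  proof (cases "emeasure M (A n) = 0")
    case True
    then have "A n \<in> null_sets M" by auto
    then show ?thesis by (simp add: nn_integral_null_set)
  next
    case False
    have cancel: "x / emeasure M (A n) * emeasure M (A n) = x" for x
      using False mult_divide_eq_ennreal[of "emeasure M (A n)" x]
      by (subst mult.commute, subst ennreal_times_divide) (simp add: mult.commute)
    have "(\<integral>\<^sup>+\<omega>. E F \<omega> * indicator (A n) \<omega> \<partial>M) / emeasure M (A n)
        = (\<integral>\<^sup>+\<omega>. E F' \<omega> * indicator (A n) \<omega> \<partial>M) / emeasure M (A n)"
      unfolding cond[OF F] cond[OF F']
      by (rule nn_integral_cong, rule sum.cong[OF refl], rule arg_cong2[where f = "(*)", OF refl eq]) auto
    from arg_cong[OF this, of "\<lambda>x. x * emeasure M (A n)"] show ?thesis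
      unfolding cancel .
  qed
  have total: "(\<integral>\<^sup>+\<theta>. F \<theta> \<partial>sample_law M P m) = (\<Sum>n. \<integral>\<^sup>+\<omega>. E F \<omega> * indicator (A n) \<omega> \<partial>M)"
    if F: "F \<in> borel_measurable (\<Pi>\<^sub>M i\<in>{..<m}. S)" for F
  proof -
    have "(\<integral>\<^sup>+\<theta>. F \<theta> \<partial>sample_law M P m) = (\<integral>\<^sup>+\<omega>. E F \<omega> \<partial>M)"
      unfolding sample_law_def E_def by (rule nn_integral_bind[OF F K])
    also have "\<dots> = (\<integral>\<^sup>+\<omega>. (\<Sum>n. E F \<omega> * indicator (A n) \<omega>) \<partial>M)"
    proof (rule nn_integral_cong)
      fix \<omega> assume "\<omega> \<in> space M"
      then have "(\<Sum>n. E F \<omega> * indicator (A n) \<omega>) = (\<Sum>n\<in>{N \<omega>}. E F \<omega> * indicator (A n) \<omega>)"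
        by (intro suminf_finite) (auto simp: A_def)
      then show "E F \<omega> = (\<Sum>n. E F \<omega> * indicator (A n) \<omega>)"
        using \<open>\<omega> \<in> space M\<close> by (simp add: A_def)
    qed
    also have "\<dots> = (\<Sum>n. \<integral>\<^sup>+\<omega>. E F \<omega> * indicator (A n) \<omega> \<partial>M)"
      by (intro nn_integral_suminf borel_measurable_times_ennreal E_meas[OF F] borel_measurable_indicator A)
    finally show ?thesis .
  qed
  show ?thesis
    unfolding total[OF F] total[OF F'] slice ..
qed

text \<open>Both sides compute the probability that the \<open>i\<close>-th sample value lies in \<open>A i\<close> for every
  \<open>i\<close>: the left one conditions on \<open>P\<close>, the right one on the ties, given which the distinct
  sample values are iid from \<open>S\<close>.\<close>

theorem mixed_moment_eq_ties:
  assumes M: "prob_space M" and crm: "eps_NormCRM \<rho> \<kappa> S \<epsilon> M P"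
    and A: "\<And>i. i < m \<Longrightarrow> A i \<in> sets S"
  shows "(\<integral>\<omega>. (\<Prod>i<m. measure (P \<omega>) (A i)) \<partial>M) =
    (\<integral>\<theta>. (\<Prod>C\<in>ties_partition m \<theta>. measure S (\<Inter>i\<in>C. A i)) \<partial>sample_law M P m)"
proof -
  interpret M: prob_space M by (rule M)
  obtain N J \<tau> where V: "eps_NormCRM_variables \<rho> \<kappa> S \<epsilon> M N J \<tau>"
    and P: "\<And>\<omega>. \<omega> \<in> space M \<Longrightarrow> P \<omega> = normalized_atoms S (N \<omega>) (\<lambda>j. J j \<omega>) (\<lambda>j. \<tau> j \<omega>)"
    using crm unfolding eps_NormCRM_def by blast
  have Pm: "P \<in> M \<rightarrow>\<^sub>M prob_algebra S" by (rule measurable_eps_NormCRM[OF crm])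
  have P': "prob_space (P \<omega>)" "sets (P \<omega>) = sets S" if "\<omega> \<in> space M" for \<omega>
    using measurable_space[OF Pm that] by (auto simp: space_prob_algebra)
  have K: "(\<lambda>\<omega>. \<Pi>\<^sub>M i\<in>{..<m}. P \<omega>) \<in> M \<rightarrow>\<^sub>M subprob_algebra (\<Pi>\<^sub>M i\<in>{..<m}. S)"
    by (rule measurable_prob_algebraD[OF measurable_sample_kernel[OF Pm]])
  have sets_law: "sets (sample_law M P m) = sets (\<Pi>\<^sub>M i\<in>{..<m}. S)"
    unfolding sample_law_def by (rule sets_bind_measurable[OF K M.not_empty])
  let ?r = "\<lambda>\<theta>. \<Prod>C\<in>ties_partition m \<theta>. measure S (\<Inter>i\<in>C. A i)"
  let ?F = "indicator (Pi\<^sub>E {..<m} A) :: _ \<Rightarrow> ennreal"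
  let ?F' = "\<lambda>\<theta>. \<Prod>C\<in>ties_partition m \<theta>. emeasure S (\<Inter>i\<in>C. A i)"
  have box: "Pi\<^sub>E {..<m} A \<in> sets (\<Pi>\<^sub>M i\<in>{..<m}. S)"
    using A by (intro sets_PiM_I_finite) auto
  have F: "?F \<in> borel_measurable (\<Pi>\<^sub>M i\<in>{..<m}. S)" using box by simp
  have F': "?F' \<in> borel_measurable (\<Pi>\<^sub>M i\<in>{..<m}. S)"
    by (rule measurable_compose[OF measurable_ties_partition]) simp
  have r: "?r \<in> borel_measurable (sample_law M P m)"
    unfolding measurable_cong_sets[OF sets_law refl]
    by (rule measurable_compose[OF measurable_ties_partition]) simp
  have l: "(\<lambda>\<omega>. \<Prod>i<m. measure (P \<omega>) (A i)) \<in> borel_measurable M"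
    using A by (intro borel_measurable_prod measurable_compose[OF Pm measurable_measure_prob_algebra]) auto
  have "(\<integral>\<omega>. (\<Prod>i<m. measure (P \<omega>) (A i)) \<partial>M) = enn2real (\<integral>\<^sup>+\<omega>. ennreal (\<Prod>i<m. measure (P \<omega>) (A i)) \<partial>M)"
    by (intro integral_eq_nn_integral l) (auto intro!: prod_nonneg)
  also have "(\<integral>\<^sup>+\<omega>. ennreal (\<Prod>i<m. measure (P \<omega>) (A i)) \<partial>M) = (\<integral>\<^sup>+\<omega>. \<integral>\<^sup>+\<theta>. ?F \<theta> \<partial>(\<Pi>\<^sub>M i\<in>{..<m}. P \<omega>) \<partial>M)"
  proof (rule nn_integral_cong)
    fix \<omega> assume \<omega>: "\<omega> \<in> space M"
    interpret Q: prob_space "P \<omega>" by (rule P'(1)[OF \<omega>])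
    interpret product_sigma_finite "\<lambda>_::nat. P \<omega>" ..
    have "(\<integral>\<^sup>+\<theta>. ?F \<theta> \<partial>(\<Pi>\<^sub>M i\<in>{..<m}. P \<omega>)) = emeasure (\<Pi>\<^sub>M i\<in>{..<m}. P \<omega>) (Pi\<^sub>E {..<m} A)"
      using A P'(2)[OF \<omega>] by (intro nn_integral_indicator sets_PiM_I_finite) auto
    also have "\<dots> = (\<Prod>i<m. emeasure (P \<omega>) (A i))"
      using A P'(2)[OF \<omega>] by (intro emeasure_PiM) auto
    finally show "ennreal (\<Prod>i<m. measure (P \<omega>) (A i)) = (\<integral>\<^sup>+\<theta>. ?F \<theta> \<partial>(\<Pi>\<^sub>M i\<in>{..<m}. P \<omega>))"
      by (simp add: Q.emeasure_eq_measure prod_ennreal)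
  qed
  also have "\<dots> = (\<integral>\<^sup>+\<theta>. ?F \<theta> \<partial>sample_law M P m)"
    unfolding sample_law_def by (rule nn_integral_bind[OF F K, symmetric])
  also have "\<dots> = (\<integral>\<^sup>+\<theta>. ?F' \<theta> \<partial>sample_law M P m)"
    by (rule nn_integral_sample_law_eqI[OF M V P F F' nn_integral_locations]) (use A in auto)
  also have "\<dots> = (\<integral>\<^sup>+\<theta>. ennreal (?r \<theta>) \<partial>sample_law M P m)"
    by (simp add: emeasure_eq_measure prod_ennreal)
  also have "enn2real \<dots> = (\<integral>\<theta>. ?r \<theta> \<partial>sample_law M P m)"
    by (intro integral_eq_nn_integral[symmetric] r) (auto intro!: prod_nonneg)
  finally show ?thesis .
qed

corollary moment_eq_num_distinct:
  assumes "prob_space M" "eps_NormCRM \<rho> \<kappa> S \<epsilon> M P" "B \<in> sets S"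
  shows "(\<integral>\<omega>. measure (P \<omega>) B ^ m \<partial>M)
    = (\<integral>\<theta>. measure S B ^ num_distinct m \<theta> \<partial>sample_law M P m)"
proof -
  have "(\<Prod>C\<in>ties_partition m \<theta>. measure S (\<Inter>i\<in>C. B)) = measure S B ^ num_distinct m \<theta>" for \<theta> :: "nat \<Rightarrow> 'a"
  proof -
    have "(\<Prod>C\<in>ties_partition m \<theta>. measure S (\<Inter>i\<in>C. B)) = (\<Prod>C\<in>ties_partition m \<theta>. measure S B)"
    proof (rule prod.cong[OF refl])
      fix C assume "C \<in> ties_partition m \<theta>"
      then have "C \<noteq> {}" by (auto simp: ties_partition_eq_fibres)
      then show "measure S (\<Inter>i\<in>C. B) = measure S B" by simp
    qed
    then show ?thesis by (simp add: card_ties_partition)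
  qed
  then show ?thesis
    using mixed_moment_eq_ties[OF assms(1,2), of m "\<lambda>_. B"] assms(3) by simp
qed

text \<open>For \<open>m = 2\<close> the sample has either a tie, with probability \<open>p(2)\<close>, or two distinct values,
  so that \<open>E(P(B1) P(B2)) = p(2) P0(B1 \<inter> B2) + (1 - p(2)) P0(B1) P0(B2)\<close>; and \<open>E(P(B)) = P0(B)\<close>.\<close>

corollary covariance_eq_eppf:
  assumes M: "prob_space M" and crm: "eps_NormCRM \<rho> \<kappa> S \<epsilon> M P"
    and B: "B1 \<in> sets S" "B2 \<in> sets S"
  shows "covariance M (\<lambda>\<omega>. measure (P \<omega>) B1) (\<lambda>\<omega>. measure (P \<omega>) B2)
    = eppf M P [2] * (measure S (B1 \<inter> B2) - measure S B1 * measure S B2)"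
proof -
  interpret M: prob_space M by (rule M)
  have Pm: "P \<in> M \<rightarrow>\<^sub>M prob_algebra S" by (rule measurable_eps_NormCRM[OF crm])
  have kernel: "(\<lambda>\<omega>. \<Pi>\<^sub>M i\<in>{..<m}. P \<omega>) \<in> M \<rightarrow>\<^sub>M prob_algebra (\<Pi>\<^sub>M i\<in>{..<m::nat}. S)" for m
    by (rule measurable_sample_kernel[OF Pm])
  have Q: "prob_space (sample_law M P m)" for m
    unfolding sample_law_def
    by (rule prob_space_bind'[OF _ kernel]) (simp add: space_prob_algebra M)
  have sets_law: "sets (sample_law M P m) = sets (\<Pi>\<^sub>M i\<in>{..<m}. S)" for m
    unfolding sample_law_def
    by (rule sets_bind_measurable[OF measurable_prob_algebraD[OF kernel] M.not_empty])
  interpret Q: prob_space "sample_law M P 2" by (rule Q)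
  have X_meas: "(\<lambda>\<omega>. measure (P \<omega>) B) \<in> borel_measurable M" if "B \<in> sets S" for B
    using that by (intro measurable_compose[OF Pm measurable_measure_prob_algebra])
  have X_le: "measure (P \<omega>) B \<le> 1" if "\<omega> \<in> space M" for \<omega> B
    using measurable_space[OF Pm that] by (auto simp: space_prob_algebra intro: prob_space.prob_le_1)
  have X_int: "integrable M (\<lambda>\<omega>. measure (P \<omega>) B)" if "B \<in> sets S" for B
    by (rule M.integrable_const_bound[where B = 1, OF _ X_meas[OF that]]) (auto intro!: AE_I2 X_le)
  have XY_int: "integrable M (\<lambda>\<omega>. measure (P \<omega>) B1 * measure (P \<omega>) B2)"
    using B by (intro M.integrable_const_bound[where B = 1])
      (auto intro!: AE_I2 X_le mult_le_one borel_measurable_times X_meas)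
  have mean: "(\<integral>\<omega>. measure (P \<omega>) B \<partial>M) = measure S B" if "B \<in> sets S" for B
  proof -
    show ?thesis
      using moment_eq_num_distinct[OF M crm that, of 1]
      by (simp add: num_distinct_def lessThan_Suc prob_space.prob_space[OF Q])
  qed
  define D where "D = {\<theta>\<in>space (sample_law M P 2). ties_partition 2 \<theta> = consecutive_partition [2]}"
  have D: "D \<in> sets (sample_law M P 2)"
  proof -
    have "D = ties_partition 2 -` {consecutive_partition [2]} \<inter> space (\<Pi>\<^sub>M i\<in>{..<2}. S)"
      unfolding D_def sets_eq_imp_space_eq[OF sets_law] by auto
    then show ?thesis
      unfolding sets_law by (simp only: measurable_sets[OF measurable_ties_partition] sets_count_space UNIV_I Pow_UNIV)
  qed
  have eppf: "eppf M P [2] = measure (sample_law M P 2) D"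
    by (simp add: eppf_def D_def)
  let ?a = "measure S (B1 \<inter> B2)" and ?b = "measure S B1 * measure S B2"
  have "(\<integral>\<omega>. measure (P \<omega>) B1 * measure (P \<omega>) B2 \<partial>M)
      = (\<integral>\<omega>. (\<Prod>i<2. measure (P \<omega>) (if i = (0::nat) then B1 else B2)) \<partial>M)"
    by (simp add: numeral_2_eq_2 lessThan_Suc mult.commute)
  also have "\<dots> = (\<integral>\<theta>. (\<Prod>C\<in>ties_partition 2 \<theta>. measure S (\<Inter>i\<in>C. if i = (0::nat) then B1 else B2)) \<partial>sample_law M P 2)"
    by (rule mixed_moment_eq_ties[OF M crm]) (simp add: B)
  also have "\<dots> = (\<integral>\<theta>. ?b + (?a - ?b) * indicator D \<theta> \<partial>sample_law M P 2)"
  proof (rule Bochner_Integration.integral_cong[OF refl])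
    fix \<theta> assume \<theta>: "\<theta> \<in> space (sample_law M P 2)"
    show "(\<Prod>C\<in>ties_partition 2 \<theta>. measure S (\<Inter>i\<in>C. if i = (0::nat) then B1 else B2))
        = ?b + (?a - ?b) * indicator D \<theta>"
    proof (cases "\<theta> 0 = \<theta> 1")
      case True
      then have "\<theta> \<in> D" using \<theta> by (simp add: D_def ties_partition_2 consecutive_partition_2)
      with True show ?thesis by (simp add: ties_partition_2 Int_commute)
    next
      case False
      have "{{0}, {1}} \<noteq> {{0, 1::nat}}" by (auto simp: set_eq_iff)
      with False have "\<theta> \<notin> D" by (simp add: D_def ties_partition_2 consecutive_partition_2)
      with False show ?thesis by (simp add: ties_partition_2)
    qed
  qed
  also have "\<dots> = ?b + (?a - ?b) * eppf M P [2]"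
  proof -
    have "integrable (sample_law M P 2) (indicator D :: _ \<Rightarrow> real)"
      using D by (simp add: Q.emeasure_eq_measure)
    then show ?thesis using D by (simp add: Q.prob_space eppf)
  qed
  finally have XY: "(\<integral>\<omega>. measure (P \<omega>) B1 * measure (P \<omega>) B2 \<partial>M) = ?b + (?a - ?b) * eppf M P [2]" .
  have "covariance M (\<lambda>\<omega>. measure (P \<omega>) B1) (\<lambda>\<omega>. measure (P \<omega>) B2)
      = (\<integral>\<omega>. measure (P \<omega>) B1 * measure (P \<omega>) B2 - measure S B2 * measure (P \<omega>) B1
          - measure S B1 * measure (P \<omega>) B2 + ?b \<partial>M)"
    unfolding covariance_def mean[OF B(1)] mean[OF B(2)]
    by (intro Bochner_Integration.integral_cong) (auto simp: algebra_simps)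
  also have "\<dots> = (?b + (?a - ?b) * eppf M P [2]) - ?b - ?b + ?b"
    using XY_int X_int[OF B(1)] X_int[OF B(2)]
    by (simp add: XY mean B M.prob_space)
  finally show ?thesis by (simp add: algebra_simps)
qed

end

text \<open>A point of positive mass would be an atom, and the diagonal of a second countable Hausdorff
  space is measurable for the product of the Borel sets.\<close>

lemma diffuse_prob_space_nonatomic:
  fixes P0 :: "'a::{second_countable_topology, t2_space} measure"
  assumes "prob_space P0" and sets: "sets P0 = sets (restrict_space borel \<Theta>)"
    and na: "nonatomic P0"
  shows "diffuse_prob_space P0"
proof -
  interpret prob_space P0 by fact
  show ?thesis
  proof
    have id [measurable]: "(\<lambda>x. x) \<in> P0 \<rightarrow>\<^sub>M borel"
      by (simp add: measurable_cong_sets[OF sets refl] measurable_restrict_space1)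
    have "Measurable.pred (P0 \<Otimes>\<^sub>M P0) (\<lambda>z. fst z = snd z)"
      unfolding pred_def
      by (intro measurable_equality_set measurable_compose[OF measurable_fst id] measurable_compose[OF measurable_snd id])
    then show "Measurable.pred (P0 \<Otimes>\<^sub>M P0) (\<lambda>(x, y). x = y)" by (simp add: split_beta)
  next
    fix x
    show "emeasure P0 {x} = 0"
    proof (rule ccontr)
      assume pos: "emeasure P0 {x} \<noteq> 0"
      then have "{x} \<in> sets P0" using emeasure_notin_sets by blast
      moreover have "emeasure P0 B = 0" if "B \<subseteq> {x}" "emeasure P0 B < emeasure P0 {x}" for B
        using that by (auto simp: subset_singleton_iff)
      ultimately show False
        using na pos unfolding nonatomic_def by (metis not_gr_zero)
    qed
  qed
qed

theorem mainTheorem6: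
  fixes \<Theta> :: "'a::euclidean_space set" and P0 :: "'a measure"
    and \<rho> :: "real \<Rightarrow> real" and \<kappa> \<epsilon> :: real
    and M :: "'w measure" and P :: "'w \<Rightarrow> 'a measure"
  assumes "\<Theta> \<in> sets borel"
    and "prob_space P0" and "sets P0 = sets (restrict_space borel \<Theta>)"
    and "\<kappa> > 0"
    and "\<rho> \<in> borel_measurable (restrict_space borel {0<..})"
    and "\<And>s. s > 0 \<Longrightarrow> \<rho> s \<ge> 0"
    and "(\<integral>\<^sup>+s\<in>{0<..}. ennreal (min 1 s * \<rho> s) \<partial>lborel) < \<infinity>"
    and "(\<integral>\<^sup>+s\<in>{0<..}. ennreal (\<rho> s) \<partial>lborel) = \<infinity>"
    and "\<epsilon> > 0" and "Lam \<rho> \<kappa> \<epsilon> > 0"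
    and "nonatomic P0"
    and "prob_space M" and "eps_NormCRM \<rho> \<kappa> P0 \<epsilon> M P"
  shows "(\<forall>B m. B \<in> sets borel \<and> B \<subseteq> \<Theta> \<and> m \<ge> 1 \<longrightarrow>
            (\<integral>\<omega>. measure (P \<omega>) B ^ m \<partial>M)
              = (\<integral>\<theta>. measure P0 B ^ num_distinct m \<theta> \<partial>sample_law M P m))
       \<and> (\<forall>B. B \<in> sets borel \<and> B \<subseteq> \<Theta> \<longrightarrow>
            prob_space.variance M (\<lambda>\<omega>. measure (P \<omega>) B)
              = eppf M P [2] * measure P0 B * (1 - measure P0 B))
       \<and> (\<forall>B1 B2. B1 \<in> sets borel \<and> B1 \<subseteq> \<Theta> \<and> B2 \<in> sets borel \<and> B2 \<subseteq> \<Theta> \<longrightarrow>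
            covariance M (\<lambda>\<omega>. measure (P \<omega>) B1) (\<lambda>\<omega>. measure (P \<omega>) B2)
              = eppf M P [2] * (measure P0 (B1 \<inter> B2) - measure P0 B1 * measure P0 B2))"
proof -
  interpret diffuse_prob_space P0
    using assms by (intro diffuse_prob_space_nonatomic)
  have sets: "B \<in> sets P0" if "B \<in> sets borel" "B \<subseteq> \<Theta>" for B
    using that assms by (simp add: sets_restrict_space_iff)
  have "prob_space.variance M (\<lambda>\<omega>. measure (P \<omega>) B) = eppf M P [2] * measure P0 B * (1 - measure P0 B)"
    if "B \<in> sets borel" "B \<subseteq> \<Theta>" for B
    using covariance_eq_eppf[OF assms(12,13) sets[OF that] sets[OF that]]
    by (simp add: covariance_def power2_eq_square algebra_simps)
  then show ?thesis
    by (intro conjI allI impI moment_eq_num_distinct[OF assms(12,13)]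
        covariance_eq_eppf[OF assms(12,13)] sets) auto
qed

end
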